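(* For any nonempty compact metric spaces $X$ and $Y$ there exist: (1) a correspondence $R\in\mathcal{R}(X,Y)$ such that $d_{GH}(X,Y)=\frac12\operatorname{dis}R$; (2) a pseudometric $\rho$ on the disjoint union $X\sqcup Y$, whose restrictions to $X$ and to $Y$ coincide with the initial metrics of these spaces, such that $d_{GH}(X,Y)=d_H(X,Y,\rho)$; (3) a metric space $Z$ and isometric embeddings of $X$ and $Y$ into $Z$ such that the Hausdorff distance between their images equals $d_{GH}(X,Y)$.
   Context: For a metric space $Z$ and nonempty subsets $A,B\subset Z$, the Hausdorff distance is $d_H(A,B)=\max\bigl\{\sup_{a\in A}\inf_{b\in B}|ab|,\ \sup_{b\in B}\inf_{a\in A}|ba|\bigr\}$, where $|xy|$ denotes the distance between points $x,y$. The Gromov--Hausdorff distance $d_{GH}(X,Y)$ between metric spaces $X$ and $Y$ is the infimum of those $r$ for which there exist a metric space $Z$ and subsets $X',Y'\subset Z$ isometric to $X$ and $Y$ respectively (with the restricted metrics) such that $d_H(X',Y')\le r$. Isometric embeddings are distance-preserving maps (not necessarily surjective). A correspondence between $X$ and $Y$ is a subset $R\subset X\times Y$ such that the restrictions to $R$ of the projections $(x,y)\mapsto x$ and $(x,y)\mapsto y$ are surjective onto $X$ and $Y$; $\mathcal{R}(X,Y)$ is the set of all correspondences between $X$ and $Y$. The distortion of a nonempty $\sigma\subset X\times Y$ is $\operatorname{dis}\sigma=\sup\bigl\{\bigl||xx'|-|yy'|\bigr|:(x,y)\in\sigma,\ (x',y')\in\sigma\bigr\}$. For a pseudometric $\rho$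 on $X\sqcup Y$ whose restrictions to $X$ and $Y$ coincide with the initial metrics of these spaces, let $(X\sqcup Y)/\rho$ be the metric space obtained from $X\sqcup Y$ by identifying points at zero $\rho$-distance, and let $\pi\colon X\sqcup Y\to(X\sqcup Y)/\rho$ be the canonical projection (its restrictions to $X$ and $Y$ are isometric embeddings). Then $d_H(X,Y,\rho)$ denotes the Hausdorff distance $d_H\bigl(\pi(X),\pi(Y)\bigr)$ in $(X\sqcup Y)/\rho$. *)

theory Defs
  imports "HOL-Analysis.Analysis"
begin

text \<open>
  Suprema and infima of distances are taken in \<open>ennreal\<close>, so that the possible value
  \<open>\<infinity>\<close> (unbounded sets) is represented honestly.
\<close>

definition hausdorff_dist :: "'c metric \<Rightarrow> 'c set \<Rightarrow> 'c set \<Rightarrow> ennreal" where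
  "hausdorff_dist Z A B =
     max (SUP a\<in>A. INF b\<in>B. ennreal (mdist Z a b)) (SUP b\<in>B. INF a\<in>A. ennreal (mdist Z b a))"

definition isometric_embedding :: "'a metric \<Rightarrow> 'b metric \<Rightarrow> ('a \<Rightarrow> 'b) \<Rightarrow> bool" where
  "isometric_embedding X Z f \<longleftrightarrow>
     f \<in> mspace X \<rightarrow> mspace Z \<and>
     (\<forall>x\<in>mspace X. \<forall>x'\<in>mspace X. mdist Z (f x) (f x') = mdist X x x')"

definition isometric :: "'a metric \<Rightarrow> 'b metric \<Rightarrow> bool" where
  "isometric X Y \<longleftrightarrow> (\<exists>f. isometric_embedding X Y f \<and> f ` mspace X = mspace Y)"

text \<open>
  A formula cannot quantify over the type carrying \<open>Z\<close>. Only the subspace \<open>X' \<union> Y'\<close> of \<open>Z\<close>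
  matters, and it always has a copy inside the type \<open>'a + 'b\<close>; lemma \<open>gh_dist_le\<close> below
  shows that spaces \<open>Z\<close> over any other type do not change the infimum.
\<close>

definition gh_dist :: "'a metric \<Rightarrow> 'b metric \<Rightarrow> ennreal" where
  "gh_dist X Y = Inf {r. \<exists>(Z :: ('a + 'b) metric) X' Y'.
     X' \<subseteq> mspace Z \<and> Y' \<subseteq> mspace Z \<and>
     isometric X (submetric Z X') \<and> isometric Y (submetric Z Y') \<and>
     hausdorff_dist Z X' Y' \<le> r}"

definition correspondences :: "'a metric \<Rightarrow> 'b metric \<Rightarrow> ('a \<times> 'b) set set" where
  "correspondences X Y =
     {R. R \<subseteq> mspace X \<times> mspace Y \<and> fst ` R = mspace X \<and> snd ` R = mspace Y}"

definition distortion :: "'a metric \<Rightarrow> 'b metric \<Rightarrow> ('a \<times> 'b) set \<Rightarrow> ennreal" where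
  "distortion X Y \<sigma> =
     (SUP (x, y)\<in>\<sigma>. SUP (x', y')\<in>\<sigma>. ennreal \<bar>mdist X x x' - mdist Y y y'\<bar>)"

definition pseudometric_on :: "'c set \<Rightarrow> ('c \<Rightarrow> 'c \<Rightarrow> real) \<Rightarrow> bool" where
  "pseudometric_on S \<rho> \<longleftrightarrow>
     (\<forall>p\<in>S. \<forall>q\<in>S. 0 \<le> \<rho> p q) \<and>
     (\<forall>p\<in>S. \<rho> p p = 0) \<and>
     (\<forall>p\<in>S. \<forall>q\<in>S. \<rho> p q = \<rho> q p) \<and>
     (\<forall>p\<in>S. \<forall>q\<in>S. \<forall>s\<in>S. \<rho> p s \<le> \<rho> p q + \<rho> q s)"

definition extends_metrics :: "'a metric \<Rightarrow> 'b metric \<Rightarrow> ('a + 'b \<Rightarrow> 'a + 'b \<Rightarrow> real) \<Rightarrow> bool" where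
  "extends_metrics X Y \<rho> \<longleftrightarrow>
     (\<forall>x\<in>mspace X. \<forall>x'\<in>mspace X. \<rho> (Inl x) (Inl x') = mdist X x x') \<and>
     (\<forall>y\<in>mspace Y. \<forall>y'\<in>mspace Y. \<rho> (Inr y) (Inr y') = mdist Y y y')"

definition zero_dist_rel :: "'c set \<Rightarrow> ('c \<Rightarrow> 'c \<Rightarrow> real) \<Rightarrow> ('c \<times> 'c) set" where
  "zero_dist_rel S \<rho> = {(p, q) \<in> S \<times> S. \<rho> p q = 0}"

text \<open>
  The distance between two classes is that of arbitrary representatives. It is cut off to 0 outside
  the quotient because \<open>metric\<close> expects a function that is nonnegative and symmetric everywhere.
\<close>

definition quotient_metric :: "'c set \<Rightarrow> ('c \<Rightarrow> 'c \<Rightarrow> real) \<Rightarrow> 'c set metric" where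
  "quotient_metric S \<rho> =
     metric (S // zero_dist_rel S \<rho>,
       \<lambda>A B. if A \<in> S // zero_dist_rel S \<rho> \<and> B \<in> S // zero_dist_rel S \<rho>
             then \<rho> (SOME p. p \<in> A) (SOME q. q \<in> B) else 0)"

definition quotient_proj :: "'c set \<Rightarrow> ('c \<Rightarrow> 'c \<Rightarrow> real) \<Rightarrow> 'c \<Rightarrow> 'c set" where
  "quotient_proj S \<rho> p = zero_dist_rel S \<rho> `` {p}"

definition hausdorff_dist_via ::
  "'a metric \<Rightarrow> 'b metric \<Rightarrow> ('a + 'b \<Rightarrow> 'a + 'b \<Rightarrow> real) \<Rightarrow> ennreal" where
  "hausdorff_dist_via X Y \<rho> =
     (let S = mspace X <+> mspace Y; \<pi> = quotient_proj S \<rho>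
      in hausdorff_dist (quotient_metric S \<rho>) (\<pi> ` Inl ` mspace X) (\<pi> ` Inr ` mspace Y))"

lemma equiv_zero_dist_rel:
  assumes "pseudometric_on S \<rho>"
  shows "equiv S (zero_dist_rel S \<rho>)"
proof (rule equivI)
  show "zero_dist_rel S \<rho> \<subseteq> S \<times> S"
    by (auto simp: zero_dist_rel_def)
  show "refl_on S (zero_dist_rel S \<rho>)"
    using assms by (auto simp: zero_dist_rel_def refl_on_def pseudometric_on_def)
  show "sym (zero_dist_rel S \<rho>)"
    using assms by (auto simp: zero_dist_rel_def sym_def pseudometric_on_def)
  show "trans (zero_dist_rel S \<rho>)"
  proof (rule transI)
    fix p q s assume "(p, q) \<in> zero_dist_rel S \<rho>" "(q, s) \<in> zero_dist_rel S \<rho>"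
    then have *: "p \<in> S" "q \<in> S" "s \<in> S" "\<rho> p q = 0" "\<rho> q s = 0"
      by (auto simp: zero_dist_rel_def)
    then have "\<rho> p s \<le> \<rho> p q + \<rho> q s" "0 \<le> \<rho> p s"
      using assms unfolding pseudometric_on_def by blast+
    then show "(p, s) \<in> zero_dist_rel S \<rho>"
      using * by (auto simp: zero_dist_rel_def)
  qed
qed

lemma zero_dist_cong:
  assumes P: "pseudometric_on S \<rho>"
    and "(p, p') \<in> zero_dist_rel S \<rho>" "(q, q') \<in> zero_dist_rel S \<rho>"
  shows "\<rho> p q = \<rho> p' q'"
proof -
  have m: "p \<in> S" "p' \<in> S" "q \<in> S" "q' \<in> S" "\<rho> p p' = 0" "\<rho> q q' = 0"
    using assms by (auto simp: zero_dist_rel_def)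
  have tri: "\<And>a b c. a \<in> S \<Longrightarrow> b \<in> S \<Longrightarrow> c \<in> S \<Longrightarrow> \<rho> a c \<le> \<rho> a b + \<rho> b c"
    and sym: "\<And>a b. a \<in> S \<Longrightarrow> b \<in> S \<Longrightarrow> \<rho> a b = \<rho> b a"
    using P unfolding pseudometric_on_def by blast+
  have "\<rho> p q \<le> \<rho> p p' + \<rho> p' q" "\<rho> p' q \<le> \<rho> p' q' + \<rho> q' q"
       "\<rho> p' q' \<le> \<rho> p' p + \<rho> p q'" "\<rho> p q' \<le> \<rho> p q + \<rho> q q'"
    by (rule tri; use m in simp)+
  then show ?thesis
    using m sym[of p p'] sym[of q q'] by linarith
qed

lemma
  assumes P: "pseudometric_on S \<rho>"
  shows mspace_quotient_metric: "mspace (quotient_metric S \<rho>) = S // zero_dist_rel S \<rho>"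
    and mdist_quotient_metric: "\<And>p q. p \<in> S \<Longrightarrow> q \<in> S \<Longrightarrow>
      mdist (quotient_metric S \<rho>) (quotient_proj S \<rho> p) (quotient_proj S \<rho> q) = \<rho> p q"
proof -
  define E where "E = zero_dist_rel S \<rho>"
  define d where "d = (\<lambda>A B. if A \<in> S // E \<and> B \<in> S // E
             then \<rho> (SOME p. p \<in> A) (SOME q. q \<in> B) else 0)"
  have eq: "equiv S E" unfolding E_def by (rule equiv_zero_dist_rel[OF P])
  have rep: "(p, SOME x. x \<in> E `` {p}) \<in> E" if "p \<in> S" for p
  proof -
    have "p \<in> E `` {p}" using equiv_class_self[OF eq that] .
    then have "(SOME x. x \<in> E `` {p}) \<in> E `` {p}" by (rule someI)
    then show ?thesis by simp
  qed
  have d: "d (E `` {p}) (E `` {q}) = \<rho> p q" if "p \<in> S" "q \<in> S" for p q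
    using zero_dist_cong[OF P rep[unfolded E_def] rep[unfolded E_def], OF that] that
    by (simp add: d_def quotientI E_def)
  have ps: "\<And>a b. a \<in> S \<Longrightarrow> b \<in> S \<Longrightarrow> 0 \<le> \<rho> a b"
      "\<And>a b. a \<in> S \<Longrightarrow> b \<in> S \<Longrightarrow> \<rho> a b = \<rho> b a"
      "\<And>a b c. a \<in> S \<Longrightarrow> b \<in> S \<Longrightarrow> c \<in> S \<Longrightarrow> \<rho> a c \<le> \<rho> a b + \<rho> b c"
    using P unfolding pseudometric_on_def by blast+
  have off: "d A B = 0" if "\<not> (A \<in> S // E \<and> B \<in> S // E)" for A B
    using that by (auto simp: d_def)
  have M: "Metric_space (S // E) d"
  proof
    fix A B
    show "0 \<le> d A B"
      by (cases "A \<in> S // E \<and> B \<in> S // E") (auto simp: off d ps elim!: quotientE)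
    show "d A B = d B A"
    proof (cases "A \<in> S // E \<and> B \<in> S // E")
      case True
      then obtain a b where ab: "a \<in> S" "b \<in> S" "A = E `` {a}" "B = E `` {b}"
        by (auto elim!: quotientE)
      then show ?thesis using ps(2)[of a b] by (simp add: d)
    next
      case False
      then show ?thesis using off[of A B] off[of B A] by auto
    qed
  next
    fix A B assume "A \<in> S // E" "B \<in> S // E"
    then obtain a b where ab: "a \<in> S" "b \<in> S" "A = E `` {a}" "B = E `` {b}"
      by (auto elim!: quotientE)
    have "A = B \<longleftrightarrow> (a, b) \<in> E"
      using ab eq_equiv_class_iff[OF eq] by simp
    then show "d A B = 0 \<longleftrightarrow> A = B"
      using ab d[of a b] by (simp add: E_def zero_dist_rel_def)
  next
    fix A B C assume "A \<in> S // E" "B \<in> S // E" "C \<in> S // E"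
    then show "d A C \<le> d A B + d B C"
      by (auto simp: d ps elim!: quotientE)
  qed
  have Q: "quotient_metric S \<rho> = metric (S // E, d)"
    by (simp add: quotient_metric_def d_def E_def)
  show "mspace (quotient_metric S \<rho>) = S // zero_dist_rel S \<rho>"
    using Metric_space.mspace_metric[OF M] by (simp add: Q E_def)
  show "mdist (quotient_metric S \<rho>) (quotient_proj S \<rho> p) (quotient_proj S \<rho> q) = \<rho> p q"
    if "p \<in> S" "q \<in> S" for p q
    using Metric_space.mdist_metric[OF M] d[OF that] by (simp add: Q E_def quotient_proj_def)
qed

lemma gh_dist_le:
  fixes Z :: "'c metric" and X :: "'a metric" and Y :: "'b metric"
  assumes X': "X' \<subseteq> mspace Z" and Y': "Y' \<subseteq> mspace Z"
    and iX: "isometric X (submetric Z X')" and iY: "isometric Y (submetric Z Y')"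
  shows "gh_dist X Y \<le> hausdorff_dist Z X' Y'"
proof -
  obtain f where f: "\<And>x x'. x \<in> mspace X \<Longrightarrow> x' \<in> mspace X \<Longrightarrow> mdist Z (f x) (f x') = mdist X x x'"
      "f ` mspace X = X'"
    using iX X' unfolding isometric_def isometric_embedding_def mspace_submetric mdist_submetric
    by (metis Int_absorb2)
  obtain g where g: "\<And>y y'. y \<in> mspace Y \<Longrightarrow> y' \<in> mspace Y \<Longrightarrow> mdist Z (g y) (g y') = mdist Y y y'"
      "g ` mspace Y = Y'"
    using iY Y' unfolding isometric_def isometric_embedding_def mspace_submetric mdist_submetric
    by (metis Int_absorb2)
  define k where "k = case_sum f g"
  define U where "U = mspace X <+> mspace Y"
  have kU: "k ` U = X' \<union> Y'"
    using f(2) g(2) by (auto simp: k_def U_def Plus_def image_Un image_image)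
  define h where "h = inv_into U k"
  have kh: "k (h z) = z" "h z \<in> U" if "z \<in> X' \<union> Y'" for z
    using that kU by (auto simp: h_def f_inv_into_f inv_into_into)
  define W where "W = metric (h ` (X' \<union> Y'), \<lambda>p q. mdist Z (k p) (k q))"
  have inZ: "z \<in> mspace Z" if "z \<in> X' \<union> Y'" for z using that X' Y' by auto
  have M: "Metric_space (h ` (X' \<union> Y')) (\<lambda>p q. mdist Z (k p) (k q))"
  proof
    fix p q s assume "p \<in> h ` (X' \<union> Y')" "q \<in> h ` (X' \<union> Y')"
    then obtain a b where ab: "a \<in> X' \<union> Y'" "b \<in> X' \<union> Y'" "p = h a" "q = h b" by blast
    show "mdist Z (k p) (k q) = 0 \<longleftrightarrow> p = q"
      using ab kh inZ by (metis mdist_zero)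
    assume "s \<in> h ` (X' \<union> Y')"
    then obtain c where "c \<in> X' \<union> Y'" "s = h c" by blast
    then show "mdist Z (k p) (k s) \<le> mdist Z (k p) (k q) + mdist Z (k q) (k s)"
      using ab kh inZ by (simp add: mdist_triangle)
  qed (auto simp: mdist_commute)
  have W: "mspace W = h ` (X' \<union> Y')" "mdist W = (\<lambda>p q. mdist Z (k p) (k q))"
    using Metric_space.mspace_metric[OF M] Metric_space.mdist_metric[OF M] by (simp_all add: W_def)
  have sub: "h ` X' \<subseteq> mspace W" "h ` Y' \<subseteq> mspace W" by (auto simp: W)
  have mW: "mdist W (h a) (h b) = mdist Z a b" if "a \<in> X' \<union> Y'" "b \<in> X' \<union> Y'" for a b
    using that by (simp add: W kh)
  have "isometric_embedding X (submetric W (h ` X')) (h \<circ> f)"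
    using f mW sub by (auto simp: isometric_embedding_def)
  moreover have "(h \<circ> f) ` mspace X = mspace (submetric W (h ` X'))"
    using f(2) sub by (auto simp: image_comp[symmetric])
  ultimately have 1: "isometric X (submetric W (h ` X'))" unfolding isometric_def by blast
  have "isometric_embedding Y (submetric W (h ` Y')) (h \<circ> g)"
    using g mW sub by (auto simp: isometric_embedding_def)
  moreover have "(h \<circ> g) ` mspace Y = mspace (submetric W (h ` Y'))"
    using g(2) sub by (auto simp: image_comp[symmetric])
  ultimately have 2: "isometric Y (submetric W (h ` Y'))" unfolding isometric_def by blast
  have "hausdorff_dist W (h ` X') (h ` Y') = hausdorff_dist Z X' Y'"
  proof -
    have "(SUP a\<in>h ` A. INF b\<in>h ` B. ennreal (mdist W a b)) = (SUP a\<in>A. INF b\<in>B. ennreal (mdist Z a b))"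
      if "A \<subseteq> X' \<union> Y'" "B \<subseteq> X' \<union> Y'" for A B
    proof -
      have *: "mdist W (h a) (h b) = mdist Z a b" if "a \<in> A" "b \<in> B" for a b
        using that \<open>A \<subseteq> _\<close> \<open>B \<subseteq> _\<close> by (intro mW) auto
      have "(INF b\<in>h ` B. ennreal (mdist W (h a) b)) = (INF b\<in>B. ennreal (mdist Z a b))"
        if "a \<in> A" for a
        using *[OF that] by (simp add: image_image)
      then show ?thesis by (simp add: image_image)
    qed
    then show ?thesis by (simp add: hausdorff_dist_def)
  qed
  then have "hausdorff_dist W (h ` X') (h ` Y') \<le> hausdorff_dist Z X' Y'"
    by (rule eq_refl)
  then show ?thesis
    unfolding gh_dist_def
    by (intro Inf_lower CollectI exI[of _ W] exI[of _ "h ` X'"] exI[of _ "h ` Y'"] conjI sub 1 2)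
qed

end

theory Submission
  imports Defs
begin

text \<open>
  Every realisation of \<open>X\<close> and \<open>Y\<close> in a common space is a pseudometric on \<open>X \<squnion> Y\<close> extending the
  two metrics. Those with values in \<open>[0, B]\<close> form a compact set in the topology of pointwise
  convergence by Tychonoff's theorem. Since they are 1-Lipschitz in each argument, the condition
  that \<open>X\<close> and \<open>Y\<close> lie \<open>r\<close>-close to each other can be tested, up to a small error, on finite nets
  of \<open>X\<close> and \<open>Y\<close>, and there it is closed under pointwise convergence. Hence an optimal pseudometric
  \<open>\<rho>\<close> exists, which is (2); picking representatives gives (3). By compactness the relation
  \<open>\<rho>(x, y) \<le> d\<^sub>G\<^sub>H\<close> is a correspondence, of distortion at most \<open>2 d\<^sub>G\<^sub>H\<close>; conversely, a
  correspondence \<open>R\<close> with distortion \<open>2 c\<close> allows one to glue \<open>X\<close> to \<open>Y\<close> along \<open>R\<close> with bridges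
  of length \<open>c\<close>, which gives (1).
\<close>

section \<open>Hausdorff distance\<close>

lemma hausdorff_dist_leI:
  assumes "\<And>a. a \<in> A \<Longrightarrow> \<exists>b\<in>B. ennreal (mdist Z a b) \<le> r"
    and "\<And>b. b \<in> B \<Longrightarrow> \<exists>a\<in>A. ennreal (mdist Z a b) \<le> r"
  shows "hausdorff_dist Z A B \<le> r"
  unfolding hausdorff_dist_def
proof (intro max.boundedI SUP_least)
  fix a assume "a \<in> A"
  then show "(INF b\<in>B. ennreal (mdist Z a b)) \<le> r"
    using assms(1) by (meson INF_lower2)
next
  fix b assume "b \<in> B"
  then show "(INF a\<in>A. ennreal (mdist Z b a)) \<le> r"
    using assms(2) by (metis INF_lower2 mdist_commute)
qed

text \<open>Strictness produces the witnesses: an infimum below \<open>r\<close> has a term below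
  \<open>r\<close>, whereas an infimum equal to \<open>r\<close> need not be attained.\<close>

lemma hausdorff_dist_lessD:
  assumes "hausdorff_dist Z A B < r"
  shows "a \<in> A \<Longrightarrow> \<exists>b\<in>B. ennreal (mdist Z a b) < r"
    and "b \<in> B \<Longrightarrow> \<exists>a\<in>A. ennreal (mdist Z a b) < r"
proof -
  have *: "(SUP a\<in>A. INF b\<in>B. ennreal (mdist Z a b)) < r"
    "(SUP b\<in>B. INF a\<in>A. ennreal (mdist Z b a)) < r"
    using assms by (auto simp: hausdorff_dist_def)
  show "\<exists>b\<in>B. ennreal (mdist Z a b) < r" if "a \<in> A"
    using SUP_lessD[OF *(1) that] by (simp add: INF_less_iff)
  show "\<exists>a\<in>A. ennreal (mdist Z a b) < r" if "b \<in> B"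
    using SUP_lessD[OF *(2) that] by (simp add: INF_less_iff mdist_commute)
qed

section \<open>Pseudometrics on the disjoint union\<close>

text \<open>This asks for attained witnesses, so in general it is stronger than a Hausdorff distance
  at most \<open>r\<close>. Only the values of \<open>\<rho>\<close> between the two summands enter,
  which lets it be stated on \<open>\<rho>\<close> itself rather than on a quotient.\<close>

definition mutually_close ::
  "'a metric \<Rightarrow> 'b metric \<Rightarrow> ('a + 'b \<Rightarrow> 'a + 'b \<Rightarrow> real) \<Rightarrow> ennreal \<Rightarrow> bool" where
  "mutually_close X Y \<rho> r \<longleftrightarrow>
     (\<forall>x\<in>mspace X. \<exists>y\<in>mspace Y. ennreal (\<rho> (Inl x) (Inr y)) \<le> r) \<and>
     (\<forall>y\<in>mspace Y. \<exists>x\<in>mspace X. ennreal (\<rho> (Inl x) (Inr y)) \<le> r)"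

lemma hausdorff_dist_image_le:
  assumes "\<And>x y. x \<in> mspace X \<Longrightarrow> y \<in> mspace Y \<Longrightarrow> mdist Z (f x) (g y) = \<rho> (Inl x) (Inr y)"
    and "mutually_close X Y \<rho> r"
  shows "hausdorff_dist Z (f ` mspace X) (g ` mspace Y) \<le> r"
  using assms by (intro hausdorff_dist_leI) (fastforce simp: mutually_close_def)+

lemma isometric_image:
  assumes "isometric_embedding X Z f"
  shows "isometric X (submetric Z (f ` mspace X))"
  using assms unfolding isometric_def isometric_embedding_def
  by (intro exI[of _ f]) auto

lemma gh_dist_le_embedding:
  assumes "isometric_embedding X Z f" "isometric_embedding Y Z g"
  shows "gh_dist X Y \<le> hausdorff_dist Z (f ` mspace X) (g ` mspace Y)"
  using assms
  by (intro gh_dist_le isometric_image) (auto simp: isometric_embedding_def)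

lemma hausdorff_dist_via_eq:
  "hausdorff_dist_via X Y \<rho> =
     hausdorff_dist (quotient_metric (mspace X <+> mspace Y) \<rho>)
       ((\<lambda>x. quotient_proj (mspace X <+> mspace Y) \<rho> (Inl x)) ` mspace X)
       ((\<lambda>y. quotient_proj (mspace X <+> mspace Y) \<rho> (Inr y)) ` mspace Y)"
  by (simp add: hausdorff_dist_via_def Let_def image_image)

lemma hausdorff_dist_via_le:
  assumes "pseudometric_on (mspace X <+> mspace Y) \<rho>" "mutually_close X Y \<rho> r"
  shows "hausdorff_dist_via X Y \<rho> \<le> r"
  unfolding hausdorff_dist_via_eq
  by (rule hausdorff_dist_image_le[OF _ assms(2)]) (simp add: mdist_quotient_metric[OF assms(1)] InlI InrI)

text \<open>The projection restricts to isometric embeddings of both summands. The quotient consists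
  of sets over \<open>'a + 'b\<close>, so the bound rests on \<open>gh_dist_le\<close>, which admits
  spaces over any type.\<close>

lemma gh_dist_le_via:
  assumes P: "pseudometric_on (mspace X <+> mspace Y) \<rho>" and "extends_metrics X Y \<rho>"
  shows "gh_dist X Y \<le> hausdorff_dist_via X Y \<rho>"
proof -
  have "quotient_proj (mspace X <+> mspace Y) \<rho> p \<in> mspace (quotient_metric (mspace X <+> mspace Y) \<rho>)"
    if "p \<in> mspace X <+> mspace Y" for p
    using that by (simp add: mspace_quotient_metric[OF P] quotient_proj_def quotientI)
  then show ?thesis
    unfolding hausdorff_dist_via_eq
    using assms(2)
    by (intro gh_dist_le_embedding)
       (auto simp: isometric_embedding_def mdist_quotient_metric[OF P] extends_metrics_def InlI InrI)
qed

text \<open>The metric identification of \<open>S\<close>, realised on representatives so as to stay in the same type.\<close>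

lemma metric_identification:
  fixes S :: "'c set"
  assumes P: "pseudometric_on S \<rho>"
  obtains Z :: "'c metric" and h
  where "h \<in> S \<rightarrow> mspace Z" "\<And>p q. p \<in> S \<Longrightarrow> q \<in> S \<Longrightarrow> mdist Z (h p) (h q) = \<rho> p q"
proof -
  let ?E = "zero_dist_rel S \<rho>"
  note eq = equiv_zero_dist_rel[OF P]
  define h where "h p = (SOME q. q \<in> ?E `` {p})" for p
  have rep: "(p, h p) \<in> ?E" if "p \<in> S" for p
    using someI[of "\<lambda>q. q \<in> ?E `` {p}", OF equiv_class_self[OF eq that]] by (simp add: h_def)
  have hS: "h p \<in> S" if "p \<in> S" for p
    using rep[OF that] by (simp add: zero_dist_rel_def)
  define d where "d p q = (if p \<in> S \<and> q \<in> S then \<rho> p q else 0)" for p q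
  have dh: "d (h p) (h q) = \<rho> p q" if "p \<in> S" "q \<in> S" for p q
    using zero_dist_cong[OF P rep rep] that hS by (simp add: d_def)
  have "Metric_space (h ` S) d"
  proof
    show "0 \<le> d p q" "d p q = d q p" for p q
      using P by (auto simp: d_def pseudometric_on_def)
    show "d p s \<le> d p q + d q s" if "p \<in> h ` S" "q \<in> h ` S" "s \<in> h ` S" for p q s
      using that P by (auto simp: dh pseudometric_on_def)
    show "d p q = 0 \<longleftrightarrow> p = q" if "p \<in> h ` S" "q \<in> h ` S" for p q
    proof -
      obtain a b where ab: "a \<in> S" "b \<in> S" "p = h a" "q = h b"
        using \<open>p \<in> h ` S\<close> \<open>q \<in> h ` S\<close> by blast
      \<comment> \<open>The chosen representative depends only on the class, so points at distance
        zero are sent to the same point.\<close>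
      have "h a = h b" if "\<rho> a b = 0"
      proof -
        have "?E `` {a} = ?E `` {b}"
          using equiv_class_eq[OF eq, of a b] that ab by (simp add: zero_dist_rel_def)
        then show ?thesis by (simp add: h_def)
      qed
      moreover have "d (h a) (h a) = 0"
        using P hS[OF ab(1)] by (simp add: d_def pseudometric_on_def)
      ultimately show ?thesis
        unfolding ab(3,4) using dh[OF ab(1,2)] by metis
    qed
  qed
  then show ?thesis
    using that[of h "metric (h ` S, d)"] dh
    by (simp add: Metric_space.mspace_metric Metric_space.mdist_metric)
qed

text \<open>Pull the metric of a nearly optimal realisation back along the two isometries. The
  images of \<open>X\<close> and \<open>Y\<close> may meet, so only a pseudometric results. Setting
  it to 0 off the disjoint union makes it a bounded function on the whole type, as the compactness
  argument requires.\<close>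

lemma gh_dist_lessE:
  fixes X :: "'a metric" and Y :: "'b metric"
  assumes "gh_dist X Y < r"
  obtains \<rho> where "pseudometric_on (mspace X <+> mspace Y) \<rho>" "extends_metrics X Y \<rho>"
    "mutually_close X Y \<rho> r"
    "\<And>p q. p \<notin> mspace X <+> mspace Y \<or> q \<notin> mspace X <+> mspace Y \<Longrightarrow> \<rho> p q = 0"
proof -
  obtain Z :: "('a + 'b) metric" and X' Y'
    where sub: "X' \<subseteq> mspace Z" "Y' \<subseteq> mspace Z"
      and iso: "isometric X (submetric Z X')" "isometric Y (submetric Z Y')"
      and H: "hausdorff_dist Z X' Y' < r"
    using assms unfolding gh_dist_def Inf_less_iff by (auto intro: le_less_trans)
  obtain f where f: "\<And>x x'. x \<in> mspace X \<Longrightarrow> x' \<in> mspace X \<Longrightarrow> mdist Z (f x) (f x') = mdist X x x'"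
      "f ` mspace X = X'"
    using iso(1) sub(1) unfolding isometric_def isometric_embedding_def mspace_submetric mdist_submetric
    by (metis Int_absorb2)
  obtain g where g: "\<And>y y'. y \<in> mspace Y \<Longrightarrow> y' \<in> mspace Y \<Longrightarrow> mdist Z (g y) (g y') = mdist Y y y'"
      "g ` mspace Y = Y'"
    using iso(2) sub(2) unfolding isometric_def isometric_embedding_def mspace_submetric mdist_submetric
    by (metis Int_absorb2)
  define S where "S = mspace X <+> mspace Y"
  define k where "k = case_sum f g"
  define \<rho> where "\<rho> p q = (if p \<in> S \<and> q \<in> S then mdist Z (k p) (k q) else 0)" for p q
  have kZ: "k p \<in> mspace Z" if "p \<in> S" for p
    using that f(2) g(2) sub by (auto simp: S_def k_def)
  have "pseudometric_on S \<rho>"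
    using kZ unfolding pseudometric_on_def \<rho>_def by (auto simp: mdist_commute intro: mdist_triangle)
  moreover have "extends_metrics X Y \<rho>"
    using f g by (auto simp: extends_metrics_def \<rho>_def k_def S_def InlI InrI)
  moreover have "\<rho> (Inl x) (Inr y) = mdist Z (f x) (g y)" if "x \<in> mspace X" "y \<in> mspace Y" for x y
    using that by (simp add: \<rho>_def k_def S_def InlI InrI)
  then have "mutually_close X Y \<rho> r"
    using hausdorff_dist_lessD[OF H] unfolding mutually_close_def f(2)[symmetric] g(2)[symmetric]
    by (fastforce intro: less_imp_le)
  moreover have "\<rho> p q = 0" if "p \<notin> S \<or> q \<notin> S" for p q
    using that by (auto simp: \<rho>_def)
  ultimately show ?thesis
    using that[of \<rho>] unfolding S_def by blast
qed

section \<open>Gluing along a correspondence\<close>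

text \<open>Join each pair of \<open>R\<close> by a bridge whose length \<open>c\<close> is half the
  distortion. This is just long enough that detours over the bridges do not shorten the distances
  inside \<open>X\<close> or \<open>Y\<close>. Infinite distortion makes the bound trivial.\<close>

lemma gh_dist_le_distortion:
  fixes X :: "'a metric" and Y :: "'b metric"
  assumes R: "R \<in> correspondences X Y" and ne: "mspace X \<noteq> {}"
  shows "gh_dist X Y \<le> distortion X Y R / 2"
proof (cases "distortion X Y R = top")
  case True
  then show ?thesis by (simp add: ennreal_top_divide)
next
  case False
  define c where "c = enn2real (distortion X Y R) / 2"
  have c: "0 \<le> c" "distortion X Y R = ennreal (2 * c)"
    using False by (simp_all add: c_def less_top)
  have RX: "\<And>a b. (a, b) \<in> R \<Longrightarrow> a \<in> mspace X \<and> b \<in> mspace Y"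
    and Rx: "\<And>x. x \<in> mspace X \<Longrightarrow> \<exists>y. (x, y) \<in> R"
    and Ry: "\<And>y. y \<in> mspace Y \<Longrightarrow> \<exists>x. (x, y) \<in> R"
    using R by (force simp: correspondences_def)+
  have dis: "\<bar>mdist X a a' - mdist Y b b'\<bar> \<le> 2 * c" if "(a, b) \<in> R" "(a', b') \<in> R" for a b a' b'
  proof -
    have "ennreal \<bar>mdist X a a' - mdist Y b b'\<bar> \<le> distortion X Y R"
      unfolding distortion_def
      by (rule SUP_upper2[OF that(1)], simp, rule SUP_upper2[OF that(2)], simp)
    then show ?thesis using c by (simp add: ennreal_le_iff)
  qed
  \<comment> \<open>Length of the shortest route from \<open>x\<close> to \<open>y\<close> over one
    bridge. This is a real infimum, so it is meaningful only because \<open>R\<close> is nonempty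
    and 0 is a lower bound.\<close>
  define \<delta> where "\<delta> x y = (INF (a, b)\<in>R. mdist X x a + mdist Y y b + c)" for x y
  have Rne: "R \<noteq> {}" using ne Rx by blast
  have \<delta>le: "\<delta> x y \<le> mdist X x a + mdist Y y b + c" if "(a, b) \<in> R" for x y a b
  proof -
    have "bdd_below ((\<lambda>(a, b). mdist X x a + mdist Y y b + c) ` R)"
      using c by (intro bdd_belowI2[of _ 0]) auto
    then show ?thesis unfolding \<delta>_def using cINF_lower[OF _ that] by force
  qed
  have \<delta>ge: "t \<le> \<delta> x y" if "\<And>a b. (a, b) \<in> R \<Longrightarrow> t \<le> mdist X x a + mdist Y y b + c" for t x y
    unfolding \<delta>_def using that Rne by (intro cINF_greatest) auto
  have \<delta>0: "0 \<le> \<delta> x y" for x y using c by (intro \<delta>ge) simp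
  have \<delta>X: "\<delta> x y \<le> mdist X x x' + \<delta> x' y" if "x \<in> mspace X" "x' \<in> mspace X" for x x' y
  proof -
    have "\<delta> x y - mdist X x x' \<le> \<delta> x' y"
    proof (rule \<delta>ge)
      fix a b assume "(a, b) \<in> R"
      then show "\<delta> x y - mdist X x x' \<le> mdist X x' a + mdist Y y b + c"
        using \<delta>le[of a b x y] mdist_triangle[of x X x' a] RX that by fastforce
    qed
    then show ?thesis by simp
  qed
  have \<delta>Y: "\<delta> x y \<le> mdist Y y y' + \<delta> x y'" if "y \<in> mspace Y" "y' \<in> mspace Y" for x y y'
  proof -
    have "\<delta> x y - mdist Y y y' \<le> \<delta> x y'"
    proof (rule \<delta>ge)
      fix a b assume "(a, b) \<in> R"
      then show "\<delta> x y - mdist Y y y' \<le> mdist X x a + mdist Y y' b + c"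
        using \<delta>le[of a b x y] mdist_triangle[of y Y y' b] RX that by fastforce
    qed
    then show ?thesis by simp
  qed
  \<comment> \<open>A route from \<open>x\<close> to \<open>x'\<close> through \<open>y\<close>
    crosses two bridges, of total length \<open>2 * c\<close>, which pays for the possible excess of
    \<open>mdist X a a'\<close> over \<open>mdist Y b b'\<close>. \<open>Yd\<close> is the mirror
    image.\<close>
  have Xd: "mdist X x x' \<le> \<delta> x y + \<delta> x' y"
    if "x \<in> mspace X" "x' \<in> mspace X" "y \<in> mspace Y" for x x' y
  proof -
    have "mdist X x x' - \<delta> x' y \<le> \<delta> x y"
    proof (rule \<delta>ge)
      fix a b assume ab: "(a, b) \<in> R"
      have "mdist X x x' - (mdist X x a + mdist Y y b + c) \<le> \<delta> x' y"
      proof (rule \<delta>ge)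
        fix a' b' assume ab': "(a', b') \<in> R"
        note m = RX[OF ab] RX[OF ab'] that
        have "mdist X x x' \<le> mdist X x a + mdist X a a' + mdist X x' a'"
          using mdist_triangle[of x X a x'] mdist_triangle[of a X a' x'] m
          by (simp add: mdist_commute)
        moreover have "mdist Y b b' \<le> mdist Y y b + mdist Y y b'"
          using mdist_triangle[of b Y y b'] m by (simp add: mdist_commute)
        ultimately show "mdist X x x' - (mdist X x a + mdist Y y b + c) \<le> mdist X x' a' + mdist Y y b' + c"
          using dis[OF ab ab'] by linarith
      qed
      then show "mdist X x x' - \<delta> x' y \<le> mdist X x a + mdist Y y b + c" by simp
    qed
    then show ?thesis by simp
  qed
  have Yd: "mdist Y y y' \<le> \<delta> x y + \<delta> x y'"
    if "y \<in> mspace Y" "y' \<in> mspace Y" "x \<in> mspace X" for y y' x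
  proof -
    have "mdist Y y y' - \<delta> x y' \<le> \<delta> x y"
    proof (rule \<delta>ge)
      fix a b assume ab: "(a, b) \<in> R"
      have "mdist Y y y' - (mdist X x a + mdist Y y b + c) \<le> \<delta> x y'"
      proof (rule \<delta>ge)
        fix a' b' assume ab': "(a', b') \<in> R"
        note m = RX[OF ab] RX[OF ab'] that
        have "mdist Y y y' \<le> mdist Y y b + mdist Y b b' + mdist Y y' b'"
          using mdist_triangle[of y Y b y'] mdist_triangle[of b Y b' y'] m
          by (simp add: mdist_commute)
        moreover have "mdist X a a' \<le> mdist X x a + mdist X x a'"
          using mdist_triangle[of a X x a'] m by (simp add: mdist_commute)
        ultimately show "mdist Y y y' - (mdist X x a + mdist Y y b + c) \<le> mdist X x a' + mdist Y y' b' + c"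
          using dis[OF ab ab'] by linarith
      qed
      then show "mdist Y y y' - \<delta> x y' \<le> mdist X x a + mdist Y y b + c" by simp
    qed
    then show ?thesis by simp
  qed
  define \<rho> where "\<rho> p q = (case p of
      Inl x \<Rightarrow> (case q of Inl x' \<Rightarrow> mdist X x x' | Inr y \<Rightarrow> \<delta> x y)
    | Inr y \<Rightarrow> (case q of Inl x \<Rightarrow> \<delta> x y | Inr y' \<Rightarrow> mdist Y y y'))" for p q
  have \<rho>: "\<rho> (Inl x) (Inl x') = mdist X x x'" "\<rho> (Inl x) (Inr y) = \<delta> x y"
    "\<rho> (Inr y) (Inl x) = \<delta> x y" "\<rho> (Inr y) (Inr y') = mdist Y y y'" for x x' y y'
    by (simp_all add: \<rho>_def)
  \<comment> \<open>Eight cases by the sides of the three points: \<open>Xd\<close> and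
    \<open>Yd\<close> serve when only the middle point changes side, \<open>\<delta>X\<close> and
    \<open>\<delta>Y\<close> when an end point does.\<close>
  have "\<rho> p s \<le> \<rho> p q + \<rho> q s"
    if "p \<in> mspace X <+> mspace Y" "q \<in> mspace X <+> mspace Y" "s \<in> mspace X <+> mspace Y" for p q s
    using that
  proof (elim PlusE; clarsimp simp: \<rho> mdist_triangle Xd Yd \<delta>X)
  qed (use \<delta>X \<delta>Y in \<open>fastforce simp: mdist_commute add.commute\<close>)+
  then have P: "pseudometric_on (mspace X <+> mspace Y) \<rho>"
    unfolding pseudometric_on_def by (auto simp: \<rho> \<delta>0 mdist_commute)
  have "extends_metrics X Y \<rho>" by (simp add: extends_metrics_def \<rho>)
  with P have "gh_dist X Y \<le> hausdorff_dist_via X Y \<rho>" by (rule gh_dist_le_via)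
  also have "\<dots> \<le> ennreal c"
  proof (rule hausdorff_dist_via_le[OF P])
    \<comment> \<open>Related points are joined by their own bridge, and each point of either space
      is related to some point of the other.\<close>
    have "\<delta> a b \<le> c" if "(a, b) \<in> R" for a b
    proof -
      have "mdist X a a = 0" "mdist Y b b = 0" using RX[OF that] by simp_all
      then show ?thesis using \<delta>le[OF that, of a b] by linarith
    qed
    then show "mutually_close X Y \<rho> (ennreal c)"
      unfolding mutually_close_def \<rho> by (metis RX Rx Ry ennreal_leI)
  qed
  also have "\<dots> = distortion X Y R / 2"
    using c by (simp add: divide_ennreal flip: ennreal_numeral)
  finally show ?thesis .
qed

section \<open>Compactness\<close>

lemma compact_space_bounded:
  assumes "compact_space (mtopology_of X)"
  shows "\<exists>B. \<forall>x\<in>mspace X. \<forall>y\<in>mspace X. mdist X x y \<le> B"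
proof -
  interpret Metric_space "mspace X" "mdist X" by (rule Metric_space_mspace_mdist)
  have "mbounded (mspace X)"
    using assms by (intro compactin_imp_mbounded) (simp add: mtopology_of_def compact_space_def)
  then show ?thesis unfolding mbounded_alt by blast
qed

lemma compact_space_net:
  assumes "compact_space (mtopology_of X)" "0 < e"
  shows "\<exists>N. finite N \<and> N \<subseteq> mspace X \<and> (\<forall>x\<in>mspace X. \<exists>a\<in>N. mdist X a x < e)"
proof -
  interpret Metric_space "mspace X" "mdist X" by (rule Metric_space_mspace_mdist)
  have "mtotally_bounded (mspace X)"
    using assms(1) unfolding mtopology_of_def compact_space_eq_mcomplete_mtotally_bounded by blast
  then have "\<exists>N. finite N \<and> N \<subseteq> mspace X \<and> mspace X \<subseteq> (\<Union>x\<in>N. mball x e)"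
    using assms(2) unfolding mtotally_bounded_def by blast
  then obtain N where N: "finite N" "N \<subseteq> mspace X" "mspace X \<subseteq> (\<Union>x\<in>N. mball x e)"
    by blast
  have "\<exists>a\<in>N. mdist X a x < e" if "x \<in> mspace X" for x
    using N(3) that in_mball by blast
  with N show ?thesis by blast
qed

text \<open>Swapping \<open>x\<close> and \<open>y\<close> in \<open>lip\<close> shows that
  \<open>f\<close> is 1-Lipschitz, hence continuous, so it has a minimum on the compact space. The
  minimum is at most \<open>g + e\<close> for every positive \<open>e\<close>.\<close>

lemma compact_space_attains:
  fixes f :: "'a \<Rightarrow> real"
  assumes "compact_space (mtopology_of X)" "mspace X \<noteq> {}"
    and lip: "\<And>x y. x \<in> mspace X \<Longrightarrow> y \<in> mspace X \<Longrightarrow> f x \<le> f y + mdist X x y"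
    and inf: "\<And>e. 0 < e \<Longrightarrow> \<exists>x\<in>mspace X. f x \<le> g + e"
  obtains x where "x \<in> mspace X" "f x \<le> g"
proof -
  have "\<bar>f x - f y\<bar> \<le> mdist X x y" if "x \<in> mspace X" "y \<in> mspace X" for x y
    using lip[of x y] lip[of y x] that by (simp add: mdist_commute abs_le_iff)
  then have "Lipschitz_continuous_map X euclidean_metric f"
    unfolding Lipschitz_continuous_map_def by (auto simp: dist_real_def intro!: exI[of _ 1])
  then have "continuous_map (mtopology_of X) euclideanreal f"
    using Lipschitz_continuous_imp_continuous_map by fastforce
  then have "compact (f ` mspace X)"
    using image_compactin[of "mtopology_of X" "mspace X" euclideanreal f] assms(1)
    by (simp add: compact_space_def)
  then obtain x where x: "x \<in> mspace X" "\<And>y. y \<in> mspace X \<Longrightarrow> f x \<le> f y"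
    using compact_attains_inf[of "f ` mspace X"] assms(2) by auto
  moreover have "f x \<le> g"
  proof (rule field_le_epsilon)
    fix e :: real assume "0 < e"
    then obtain y where "y \<in> mspace X" "f y \<le> g + e" using inf by blast
    then show "f x \<le> g + e" using x(2)[of y] by linarith
  qed
  ultimately show ?thesis using that by blast
qed

section \<open>Compact and closed sets in the topology of pointwise convergence\<close>

text \<open>Tychonoff's theorem, transferred from \<open>product_topology\<close> to the topology of
  the function type.\<close>

lemma compact_Pi_UNIV:
  fixes S :: "'i \<Rightarrow> 'a::topological_space set"
  assumes "\<And>i. compact (S i)"
  shows "compact (Pi UNIV S)"
proof -
  have "compactin (product_topology (\<lambda>_. euclidean) UNIV) (PiE UNIV S)"
    using assms by (simp add: compactin_PiE)
  then show ?thesis by (simp add: euclidean_product_topology PiE_UNIV_domain)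
qed

lemma closed_Collect_Ball:
  assumes "\<And>i. i \<in> I \<Longrightarrow> closed {x. P i x}"
  shows "closed {x. \<forall>i\<in>I. P i x}"
  using assms by (auto simp: Collect_ball_eq)

text \<open>An existential quantifier is a union, which preserves closedness when it is finite. This
  is why witnesses are later sought in finite nets.\<close>

lemma closed_Collect_Bex:
  assumes "finite I" "\<And>i. i \<in> I \<Longrightarrow> closed {x. P i x}"
  shows "closed {x. \<exists>i\<in>I. P i x}"
  using assms by (auto simp: Collect_bex_eq)

text \<open>A curried function of two arguments lives in an iterated product, so evaluation at a
  pair is a composition of two coordinate projections.\<close>

lemma continuous_on_apply2: "continuous_on UNIV (\<lambda>\<rho>. \<rho> p q)"
  by (rule continuous_on_product_then_coordinatewise[of UNIV "\<lambda>\<rho>. \<rho> p"]) simp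

lemmas closed_pointwise_intros =
  closed_Collect_conj closed_Collect_Ball closed_Collect_Bex closed_Collect_le closed_Collect_eq
  continuous_on_apply2 continuous_on_add continuous_on_const

lemma closed_pseudometric_on: "closed {\<rho>. pseudometric_on S \<rho>}"
  unfolding pseudometric_on_def by (intro closed_pointwise_intros)

lemma closed_extends_metrics: "closed {\<rho>. extends_metrics X Y \<rho>}"
  unfolding extends_metrics_def by (intro closed_pointwise_intros)

section \<open>An optimal pseudometric\<close>

text \<open>The full product is a correspondence, and its distortion is at most the larger of the
  two diameter bounds.\<close>

lemma gh_dist_finite:
  assumes "mspace X \<noteq> {}" "compact_space (mtopology_of X)"
    and "mspace Y \<noteq> {}" "compact_space (mtopology_of Y)"
  shows "gh_dist X Y < top"
proof -
  obtain D where D: "\<And>x y. x \<in> mspace X \<Longrightarrow> y \<in> mspace X \<Longrightarrow> mdist X x y \<le> D"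
    using compact_space_bounded[OF assms(2)] by blast
  obtain E where E: "\<And>x y. x \<in> mspace Y \<Longrightarrow> y \<in> mspace Y \<Longrightarrow> mdist Y x y \<le> E"
    using compact_space_bounded[OF assms(4)] by blast
  let ?R = "mspace X \<times> mspace Y"
  have "\<bar>mdist X x x' - mdist Y y y'\<bar> \<le> max D E"
    if "x \<in> mspace X" "x' \<in> mspace X" "y \<in> mspace Y" "y' \<in> mspace Y" for x x' y y'
    using D[of x x'] E[of y y'] that mdist_nonneg[of X x x'] mdist_nonneg[of Y y y'] by linarith
  then have "distortion X Y ?R \<le> ennreal (max D E)"
    unfolding distortion_def by (auto intro!: SUP_least ennreal_leI)
  then have "distortion X Y ?R < top"
    by (rule le_less_trans) simp
  moreover have "?R \<in> correspondences X Y"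
    using assms by (auto simp: correspondences_def)
  then have "gh_dist X Y \<le> distortion X Y ?R / 2"
    using assms by (intro gh_dist_le_distortion)
  ultimately show ?thesis
    by (metis ennreal_divide_eq_top_iff less_top neq_top_trans numeral_neq_zero order_le_less_trans)
qed

text \<open>The sets \<open>F n\<close> of pseudometrics that are optimal up to a tolerance are
  closed, and any finitely many of them meet inside the compact box \<open>K\<close>. A common
  element of all of them is optimal.\<close>

lemma ex_optimal_pseudometric:
  fixes X :: "'a metric" and Y :: "'b metric"
  assumes X: "mspace X \<noteq> {}" "compact_space (mtopology_of X)"
    and Y: "mspace Y \<noteq> {}" "compact_space (mtopology_of Y)"
  obtains \<rho> where "pseudometric_on (mspace X <+> mspace Y) \<rho>" "extends_metrics X Y \<rho>"
    "mutually_close X Y \<rho> (gh_dist X Y)"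
proof -
  obtain g where g: "0 \<le> g" "gh_dist X Y = ennreal g"
    using gh_dist_finite[OF assms] by (cases "gh_dist X Y") auto
  define S where "S = mspace X <+> mspace Y"
  have S: "Inl x \<in> S \<longleftrightarrow> x \<in> mspace X" "Inr y \<in> S \<longleftrightarrow> y \<in> mspace Y" for x y
    by (auto simp: S_def)
  obtain D where D: "\<And>x y. x \<in> mspace X \<Longrightarrow> y \<in> mspace X \<Longrightarrow> mdist X x y \<le> D"
    using compact_space_bounded[OF X(2)] by blast
  obtain E where E: "\<And>x y. x \<in> mspace Y \<Longrightarrow> y \<in> mspace Y \<Longrightarrow> mdist Y x y \<le> E"
    using compact_space_bounded[OF Y(2)] by blast
  have DE: "0 \<le> D" "0 \<le> E"
    using X(1) Y(1) D E mdist_nonneg order_trans by (metis ex_in_conv)+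
  \<comment> \<open>Bounds every value of a pseudometric whose closeness exceeds \<open>g\<close> by
    at most 1: a cross distance is at most \<open>g + 1\<close> plus a distance inside
    \<open>Y\<close>.\<close>
  define B where "B = g + 1 + D + E"
  define \<epsilon> where "\<epsilon> n = inverse (real (Suc n))" for n
  have \<epsilon>: "0 < \<epsilon> n" "\<epsilon> n \<le> 1" "m \<le> n \<Longrightarrow> \<epsilon> n \<le> \<epsilon> m" for m n
    by (auto simp: \<epsilon>_def divide_simps)
  obtain M where M: "\<And>n. finite (M n)" "\<And>n. M n \<subseteq> mspace X"
      "\<And>n x. x \<in> mspace X \<Longrightarrow> \<exists>a\<in>M n. mdist X a x < \<epsilon> n"
    using compact_space_net[OF X(2) \<epsilon>(1)] by metis
  obtain N where N: "\<And>n. finite (N n)" "\<And>n. N n \<subseteq> mspace Y"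
      "\<And>n x. x \<in> mspace Y \<Longrightarrow> \<exists>a\<in>N n. mdist Y a x < \<epsilon> n"
    using compact_space_net[OF Y(2) \<epsilon>(1)] by metis
  define K where "K = Pi UNIV (\<lambda>p::'a + 'b. Pi UNIV (\<lambda>q::'a + 'b. {0..B}))"
  \<comment> \<open>Of the slack \<open>2 * \<epsilon> n\<close>, one half allows for
    near-optimality and the other for moving a witness to a net point.\<close>
  define F where "F n = {\<rho>. (pseudometric_on S \<rho> \<and> extends_metrics X Y \<rho>) \<and>
      (\<forall>x\<in>mspace X. \<exists>y\<in>N n. \<rho> (Inl x) (Inr y) \<le> g + 2 * \<epsilon> n) \<and>
      (\<forall>y\<in>mspace Y. \<exists>x\<in>M n. \<rho> (Inl x) (Inr y) \<le> g + 2 * \<epsilon> n)}" for n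
  have triX: "\<rho> (Inl x) q \<le> \<rho> (Inl x') q + mdist X x x'"
    if "pseudometric_on S \<rho>" "extends_metrics X Y \<rho>" "x \<in> mspace X" "x' \<in> mspace X" "q \<in> S"
    for \<rho> x x' q
  proof -
    have "\<rho> (Inl x) q \<le> \<rho> (Inl x) (Inl x') + \<rho> (Inl x') q"
      using that S unfolding pseudometric_on_def by blast
    then show ?thesis using that by (simp add: extends_metrics_def)
  qed
  have triY: "\<rho> p (Inr y) \<le> \<rho> p (Inr y') + mdist Y y y'"
    if "pseudometric_on S \<rho>" "extends_metrics X Y \<rho>" "y \<in> mspace Y" "y' \<in> mspace Y" "p \<in> S"
    for \<rho> y y' p
  proof -
    have "\<rho> p (Inr y) \<le> \<rho> p (Inr y') + \<rho> (Inr y') (Inr y)"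
      using that S unfolding pseudometric_on_def by blast
    then show ?thesis using that by (simp add: extends_metrics_def mdist_commute)
  qed
  have "compact K"
    unfolding K_def by (intro compact_Pi_UNIV) simp
  moreover have "closed (F n)" for n
    unfolding F_def
    by (intro closed_Collect_conj closed_pseudometric_on closed_extends_metrics
        closed_pointwise_intros M N)
  moreover have "K \<inter> (\<Inter>n\<in>I. F n) \<noteq> {}" if "finite I" for I
  proof -
    \<comment> \<open>The largest index has the smallest tolerance, so one pseudometric for
      \<open>m\<close> serves every \<open>F n\<close> with \<open>n\<close> in \<open>I\<close>.
      Inserting 0 covers empty \<open>I\<close>.\<close>
    define m where "m = Max (insert 0 I)"
    have m: "n \<le> m" if "n \<in> I" for n
      using that \<open>finite I\<close> by (simp add: m_def)
    have "gh_dist X Y < ennreal (g + \<epsilon> m)"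
      using g \<epsilon>(1)[of m] by (simp add: ennreal_less_iff)
    then obtain \<rho> where \<rho>: "pseudometric_on S \<rho>" "extends_metrics X Y \<rho>"
        "mutually_close X Y \<rho> (ennreal (g + \<epsilon> m))" "\<And>p q. p \<notin> S \<or> q \<notin> S \<Longrightarrow> \<rho> p q = 0"
      unfolding S_def by (rule gh_dist_lessE) blast
    have le: "ennreal t \<le> ennreal (g + \<epsilon> m) \<longleftrightarrow> t \<le> g + \<epsilon> m" for t
      using g(1) \<epsilon>(1)[of m] by (intro ennreal_le_iff) simp
    have cX: "\<exists>y\<in>mspace Y. \<rho> (Inl x) (Inr y) \<le> g + \<epsilon> m" if "x \<in> mspace X" for x
      using \<rho>(3) that unfolding mutually_close_def le by blast
    have cY: "\<exists>x\<in>mspace X. \<rho> (Inl x) (Inr y) \<le> g + \<epsilon> m" if "y \<in> mspace Y" for y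
      using \<rho>(3) that unfolding mutually_close_def le by blast
    have cross: "\<rho> (Inl x) (Inr y) \<le> B" if "x \<in> mspace X" "y \<in> mspace Y" for x y
    proof -
      obtain y' where y': "y' \<in> mspace Y" "\<rho> (Inl x) (Inr y') \<le> g + \<epsilon> m"
        using cX[OF \<open>x \<in> mspace X\<close>] by blast
      have "\<rho> (Inl x) (Inr y) \<le> \<rho> (Inl x) (Inr y') + mdist Y y y'"
        using that y' by (intro triY \<rho>) (auto simp: S)
      then show ?thesis
        using y'(2) E[OF \<open>y \<in> mspace Y\<close> y'(1)] \<epsilon>(2)[of m] DE by (simp add: B_def)
    qed
    have sym: "\<rho> p q = \<rho> q p" if "p \<in> S" "q \<in> S" for p q
      using that \<rho>(1) by (simp add: pseudometric_on_def)
    have "\<rho> p q \<le> B" if "p \<in> S" "q \<in> S" for p q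
    proof (cases p; cases q)
      fix x x' assume "p = Inl x" "q = Inl x'"
      then show ?thesis using that S \<rho>(2) D[of x x'] g DE by (simp add: extends_metrics_def B_def)
    next
      fix y y' assume "p = Inr y" "q = Inr y'"
      then show ?thesis using that S \<rho>(2) E[of y y'] g DE by (simp add: extends_metrics_def B_def)
    next
      fix x y assume "p = Inl x" "q = Inr y"
      then show ?thesis using that S cross by simp
    next
      fix x y assume "p = Inr y" "q = Inl x"
      then show ?thesis using that S cross sym[of p q] by simp
    qed
    moreover have "0 \<le> \<rho> p q" if "p \<in> S" "q \<in> S" for p q
      using that \<rho>(1) by (simp add: pseudometric_on_def)
    moreover have "0 \<le> B"
      using g DE by (simp add: B_def)
    \<comment> \<open>\<open>K\<close> constrains all arguments; off \<open>S\<close> the value is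
      0, which lies in the range since \<open>B\<close> is nonnegative.\<close>
    ultimately have "0 \<le> \<rho> p q \<and> \<rho> p q \<le> B" for p q
      using \<rho>(4)[of p q] by (cases "p \<in> S \<and> q \<in> S") auto
    then have "\<rho> \<in> K" by (simp add: K_def)
    moreover have "\<rho> \<in> F n" if "n \<in> I" for n
    proof -
      have nm: "\<epsilon> m \<le> \<epsilon> n" using \<epsilon>(3) m[OF that] .
      have "\<exists>y\<in>N n. \<rho> (Inl x) (Inr y) \<le> g + 2 * \<epsilon> n" if x: "x \<in> mspace X" for x
      proof -
        obtain y where y: "y \<in> mspace Y" "\<rho> (Inl x) (Inr y) \<le> g + \<epsilon> m"
          using cX[OF x] by blast
        obtain b where b: "b \<in> N n" "mdist Y b y < \<epsilon> n"
          using N(3)[OF y(1)] by blast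
        have "\<rho> (Inl x) (Inr b) \<le> \<rho> (Inl x) (Inr y) + mdist Y b y"
          using x y b N(2) by (intro triY \<rho>) (auto simp: S)
        then show ?thesis using b y nm by (intro bexI[of _ b]) auto
      qed
      moreover have "\<exists>x\<in>M n. \<rho> (Inl x) (Inr y) \<le> g + 2 * \<epsilon> n" if y: "y \<in> mspace Y" for y
      proof -
        obtain x where x: "x \<in> mspace X" "\<rho> (Inl x) (Inr y) \<le> g + \<epsilon> m"
          using cY[OF y] by blast
        obtain a where a: "a \<in> M n" "mdist X a x < \<epsilon> n"
          using M(3)[OF x(1)] by blast
        have "\<rho> (Inl a) (Inr y) \<le> \<rho> (Inl x) (Inr y) + mdist X a x"
          using x y a M(2) by (intro triX \<rho>) (auto simp: S)
        then show ?thesis using a x nm by (intro bexI[of _ a]) auto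
      qed
      ultimately show ?thesis using \<rho> by (simp add: F_def)
    qed
    ultimately show ?thesis by blast
  qed
  ultimately have "K \<inter> (\<Inter>n\<in>UNIV. F n) \<noteq> {}"
    by (rule compact_imp_fip_image)
  then obtain \<rho> where F: "\<And>n. \<rho> \<in> F n" by blast
  have \<rho>: "pseudometric_on S \<rho>" "extends_metrics X Y \<rho>"
    using F[of 0] by (simp_all add: F_def)
  have small: "\<exists>n. 2 * \<epsilon> n \<le> e" if e: "0 < e" for e
  proof -
    obtain n where "\<epsilon> n < e / 2"
      using reals_Archimedean[of "e / 2"] e unfolding \<epsilon>_def by auto
    then show ?thesis by (intro exI[of _ n]) simp
  qed
  \<comment> \<open>The slack tends to 0 for this fixed \<open>\<rho>\<close>. Compactness of
    \<open>Y\<close> then gives a point at distance at most \<open>g\<close> exactly.\<close>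
  have "\<exists>y\<in>mspace Y. \<rho> (Inl x) (Inr y) \<le> g" if x: "x \<in> mspace X" for x
  proof (rule compact_space_attains[OF Y(2,1), of "\<lambda>y. \<rho> (Inl x) (Inr y)" g])
    show "\<rho> (Inl x) (Inr y) \<le> \<rho> (Inl x) (Inr y') + mdist Y y y'"
      if "y \<in> mspace Y" "y' \<in> mspace Y" for y y'
      using that x by (intro triY \<rho>) (auto simp: S)
    show "\<exists>y\<in>mspace Y. \<rho> (Inl x) (Inr y) \<le> g + e" if e: "0 < e" for e
    proof -
      obtain n where n: "2 * \<epsilon> n \<le> e" using small[OF e] by blast
      obtain y where "y \<in> N n" "\<rho> (Inl x) (Inr y) \<le> g + 2 * \<epsilon> n"
        using F[of n] x by (auto simp: F_def)
      then show ?thesis using N(2)[of n] n by (intro bexI[of _ y]) auto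
    qed
  qed blast
  moreover have "\<exists>x\<in>mspace X. \<rho> (Inl x) (Inr y) \<le> g" if y: "y \<in> mspace Y" for y
  proof (rule compact_space_attains[OF X(2,1), of "\<lambda>x. \<rho> (Inl x) (Inr y)" g])
    show "\<rho> (Inl x) (Inr y) \<le> \<rho> (Inl x') (Inr y) + mdist X x x'"
      if "x \<in> mspace X" "x' \<in> mspace X" for x x'
      using that y by (intro triX \<rho>) (auto simp: S)
    show "\<exists>x\<in>mspace X. \<rho> (Inl x) (Inr y) \<le> g + e" if e: "0 < e" for e
    proof -
      obtain n where n: "2 * \<epsilon> n \<le> e" using small[OF e] by blast
      obtain x where "x \<in> M n" "\<rho> (Inl x) (Inr y) \<le> g + 2 * \<epsilon> n"
        using F[of n] y by (auto simp: F_def)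
      then show ?thesis using M(2)[of n] n by (intro bexI[of _ x]) auto
    qed
  qed blast
  ultimately have "mutually_close X Y \<rho> (gh_dist X Y)"
    unfolding mutually_close_def g(2) by (blast intro: ennreal_leI)
  then show ?thesis using that \<rho> unfolding S_def by blast
qed

section \<open>From the optimal pseudometric to the three assertions\<close>

text \<open>In the quadrilateral \<open>x\<close>, \<open>y\<close>, \<open>y'\<close>,
  \<open>x'\<close> the sides \<open>x x'\<close> and \<open>y y'\<close> differ by at most the sum
  of the other two, each at most \<open>r\<close>.\<close>

lemma distortion_close_pairs_le:
  assumes P: "pseudometric_on (mspace X <+> mspace Y) \<rho>" and ext: "extends_metrics X Y \<rho>"
  shows "distortion X Y {(x, y) \<in> mspace X \<times> mspace Y. ennreal (\<rho> (Inl x) (Inr y)) \<le> r} / 2 \<le> r"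
proof -
  have "ennreal \<bar>mdist X x x' - mdist Y y y'\<bar> \<le> r * 2"
    if m: "x \<in> mspace X" "y \<in> mspace Y" "x' \<in> mspace X" "y' \<in> mspace Y"
      and r: "ennreal (\<rho> (Inl x) (Inr y)) \<le> r" "ennreal (\<rho> (Inl x') (Inr y')) \<le> r" for x y x' y'
  proof -
    let ?S = "mspace X <+> mspace Y"
    have S: "Inl x \<in> ?S" "Inl x' \<in> ?S" "Inr y \<in> ?S" "Inr y' \<in> ?S" using m by auto
    have tri: "\<And>p q s. p \<in> ?S \<Longrightarrow> q \<in> ?S \<Longrightarrow> s \<in> ?S \<Longrightarrow> \<rho> p s \<le> \<rho> p q + \<rho> q s"
      and sym: "\<And>p q. p \<in> ?S \<Longrightarrow> q \<in> ?S \<Longrightarrow> \<rho> p q = \<rho> q p"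
      and nn: "\<And>p q. p \<in> ?S \<Longrightarrow> q \<in> ?S \<Longrightarrow> 0 \<le> \<rho> p q"
      using P unfolding pseudometric_on_def by blast+
    have "\<rho> (Inl x) (Inl x') = mdist X x x'" "\<rho> (Inr y) (Inr y') = mdist Y y y'"
      using ext m by (simp_all add: extends_metrics_def)
    then have "\<bar>mdist X x x' - mdist Y y y'\<bar> \<le> \<rho> (Inl x) (Inr y) + \<rho> (Inl x') (Inr y')"
      using tri[OF S(1,3,2)] tri[OF S(3,4,2)] tri[OF S(3,1,4)] tri[OF S(1,2,4)]
        sym[OF S(1,3)] sym[OF S(2,4)] by linarith
    then have "ennreal \<bar>mdist X x x' - mdist Y y y'\<bar> \<le> ennreal (\<rho> (Inl x) (Inr y)) + ennreal (\<rho> (Inl x') (Inr y'))"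
      using nn S by (simp add: ennreal_leI flip: ennreal_plus)
    also have "\<dots> \<le> r + r" using r by (rule add_mono)
    finally show ?thesis by (simp add: mult_2_right)
  qed
  then have "distortion X Y {(x, y) \<in> mspace X \<times> mspace Y. ennreal (\<rho> (Inl x) (Inr y)) \<le> r} \<le> r * 2"
    unfolding distortion_def by (auto intro!: SUP_least)
  then have "distortion X Y {(x, y) \<in> mspace X \<times> mspace Y. ennreal (\<rho> (Inl x) (Inr y)) \<le> r} / 2 \<le> r * 2 / 2"
    by (rule divide_right_mono_ennreal)
  then show ?thesis by (simp add: ennreal_mult_divide_eq)
qed

theorem corollary2p7:
  fixes X :: "'a metric" and Y :: "'b metric"
  assumes "mspace X \<noteq> {}" and "compact_space (mtopology_of X)"
    and "mspace Y \<noteq> {}" and "compact_space (mtopology_of Y)"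
  shows "(\<exists>R \<in> correspondences X Y. gh_dist X Y = distortion X Y R / 2) \<and>
         (\<exists>\<rho>. pseudometric_on (mspace X <+> mspace Y) \<rho> \<and> extends_metrics X Y \<rho> \<and>
              gh_dist X Y = hausdorff_dist_via X Y \<rho>) \<and>
         (\<exists>(Z :: ('a + 'b) metric) f g.
              isometric_embedding X Z f \<and> isometric_embedding Y Z g \<and>
              hausdorff_dist Z (f ` mspace X) (g ` mspace Y) = gh_dist X Y)"
proof -
  obtain \<rho> where P: "pseudometric_on (mspace X <+> mspace Y) \<rho>" and ext: "extends_metrics X Y \<rho>"
    and close: "mutually_close X Y \<rho> (gh_dist X Y)"
    using ex_optimal_pseudometric[OF assms] .
  \<comment> \<open>Both projections are onto because \<open>close\<close> supplies partners at
    distance at most \<open>gh_dist X Y\<close> itself, with no slack.\<close>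
  let ?R = "{(x, y) \<in> mspace X \<times> mspace Y. ennreal (\<rho> (Inl x) (Inr y)) \<le> gh_dist X Y}"
  have R: "?R \<in> correspondences X Y"
  proof -
    have "fst ` ?R = mspace X" "snd ` ?R = mspace Y"
      using close unfolding mutually_close_def image_def by (simp; blast)+
    then show ?thesis by (auto simp: correspondences_def)
  qed
  have 1: "gh_dist X Y = distortion X Y ?R / 2"
    using gh_dist_le_distortion[OF R assms(1)] distortion_close_pairs_le[OF P ext] by (rule antisym)
  have 2: "gh_dist X Y = hausdorff_dist_via X Y \<rho>"
    using gh_dist_le_via[OF P ext] hausdorff_dist_via_le[OF P close] by (rule antisym)
  \<comment> \<open>Representatives instead of classes keep \<open>Z\<close> over the type
    \<open>'a + 'b\<close>.\<close>
  obtain Z :: "('a + 'b) metric" and h where h: "h \<in> (mspace X <+> mspace Y) \<rightarrow> mspace Z"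
    "\<And>p q. p \<in> mspace X <+> mspace Y \<Longrightarrow> q \<in> mspace X <+> mspace Y \<Longrightarrow> mdist Z (h p) (h q) = \<rho> p q"
    by (rule metric_identification[OF P]) blast
  define f where "f x = h (Inl x)" for x
  define g where "g y = h (Inr y)" for y
  have f: "isometric_embedding X Z f"
    using ext h(1) by (simp add: Pi_iff isometric_embedding_def extends_metrics_def f_def h(2) InlI)
  have g: "isometric_embedding Y Z g"
    using ext h(1) by (simp add: Pi_iff isometric_embedding_def extends_metrics_def g_def h(2) InrI)
  have "hausdorff_dist Z (f ` mspace X) (g ` mspace Y) = gh_dist X Y"
  proof (rule antisym)
    show "hausdorff_dist Z (f ` mspace X) (g ` mspace Y) \<le> gh_dist X Y"
      by (rule hausdorff_dist_image_le[OF _ close]) (simp add: h(2) f_def g_def InlI InrI)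
  qed (rule gh_dist_le_embedding[OF f g])
  then show ?thesis
    using R 1 P ext 2 f g by blast
qed

end
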